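(* Let \(k\ge 1\) be an integer and let \(G\) be a graph of strong tree-width \(k\). Then \[\operatorname{tww}(G)\leq \frac{3}{2}k + 1 + \frac{1}{2}\left(\sqrt{k + \ln k} + \sqrt{k} + 2\ln k\right).\]
   Context: All graphs are finite, simple and loopless. A trigraph is a graph whose edge set is partitioned into black edges and red edges; a graph is regarded as a trigraph with no red edges. The red degree of a vertex is its degree in the graph of red edges. For two distinct vertices \(x,y\) of a trigraph \(G\), the contraction \(G/xy\) is obtained by replacing \(x,y\) by a new vertex \(z\), keeping all edges not incident to \(x\) or \(y\), joining \(z\) by a black edge to every common black neighbour of \(x\) and \(y\), and by a red edge to every other vertex adjacent (by a red or black edge) to \(x\) or to \(y\). A contraction sequence of \(G\) is a sequence \(G=G_1,\dots,G_{|V(G)|}\) of trigraphs where each \(G_{i+1}=G_i/x_iy_i\) for distinct vertices \(x_i,y_i\) of \(G_i\), ending in a single vertex; its width is the maximum red degree of a vertex in any \(G_i\). The twin-width \(\operatorname{tww}(G)\) is the minimum width of a contraction sequence of \(G\). A strong tree decomposition of a graph \(G\) is a pair \((T,\{B_i : i\in V(T)\})\) where \(T\) is a tree and the bags \(B_i\) are pairwise disjoint subsets of \(V(G)\) with union \(V(G)\), such that for every edge \(uv\) of \(G\) either \(u,v\) lie in a common bag or \(u\in B_i, v\in B_j\) for adjacent nodes \(i,j\) of \(T\). Its width is \(\max_i |B_i|\), and the strong tree-width of \(G\) is the minimum width of a strong tree decomposition of \(G\). *)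

theory Defs
  imports Complex_Main "HOL-Library.Disjoint_Sets"
begin

record 'a graph =
  verts :: "'a set"
  edges :: "'a set set"

definition simple_graph :: "'a graph \<Rightarrow> bool" where
  "simple_graph G \<longleftrightarrow> finite (verts G) \<and> edges G \<subseteq> {e. e \<subseteq> verts G \<and> card e = 2}"

record 'a trigraph =
  tverts :: "'a set"
  black :: "'a set set"
  red :: "'a set set"

definition is_trigraph :: "'a trigraph \<Rightarrow> bool" where
  "is_trigraph H \<longleftrightarrow> finite (tverts H) \<and>
     black H \<union> red H \<subseteq> {e. e \<subseteq> tverts H \<and> card e = 2} \<and> black H \<inter> red H = {}"

definition trigraph_of :: "'a graph \<Rightarrow> 'a trigraph" where
  "trigraph_of G = \<lparr>tverts = verts G, black = edges G, red = {}\<rparr>"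

definition red_degree :: "'a trigraph \<Rightarrow> 'a \<Rightarrow> nat" where
  "red_degree H v = card {u \<in> tverts H. {v, u} \<in> red H}"

text \<open>The name \<open>z\<close> of the vertex that replaces \<open>x\<close> and \<open>y\<close> is a parameter.\<close>

definition contract :: "'a trigraph \<Rightarrow> 'a \<Rightarrow> 'a \<Rightarrow> 'a \<Rightarrow> 'a trigraph" where
  "contract H x y z =
    \<lparr>tverts = insert z (tverts H - {x, y}),
     black = {e \<in> black H. x \<notin> e \<and> y \<notin> e} \<union>
       {{z, u} | u. u \<in> tverts H - {x, y} \<and> {x, u} \<in> black H \<and> {y, u} \<in> black H},
     red = {e \<in> red H. x \<notin> e \<and> y \<notin> e} \<union>
       {{z, u} | u. u \<in> tverts H - {x, y} \<and>
          ({x, u} \<in> black H \<union> red H \<or> {y, u} \<in> black H \<union> red H) \<and>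
          \<not> ({x, u} \<in> black H \<and> {y, u} \<in> black H)}\<rparr>"

text \<open>
  The vertex \<open>z\<close> only has to differ from the vertices that remain. Allowing it to reuse the
  name \<open>x\<close> or \<open>y\<close> changes the result only up to isomorphism, and ensures that contractions
  exist even if every element of the vertex type is already a vertex.
\<close>

definition contraction_step :: "'a trigraph \<Rightarrow> 'a trigraph \<Rightarrow> bool" where
  "contraction_step H H' \<longleftrightarrow>
     (\<exists>x y z. x \<in> tverts H \<and> y \<in> tverts H \<and> x \<noteq> y \<and> z \<notin> tverts H - {x, y} \<and>
        H' = contract H x y z)"

definition contraction_sequence :: "'a trigraph \<Rightarrow> 'a trigraph list \<Rightarrow> bool" where
  "contraction_sequence H Hs \<longleftrightarrow>
     Hs \<noteq> [] \<and> hd Hs = H \<and> length Hs = card (tverts H) \<and>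
     (\<forall>i. Suc i < length Hs \<longrightarrow> contraction_step (Hs ! i) (Hs ! Suc i)) \<and>
     card (tverts (last Hs)) = 1"

definition sequence_width :: "'a trigraph list \<Rightarrow> nat" where
  "sequence_width Hs = Max {red_degree H v | H v. H \<in> set Hs \<and> v \<in> tverts H}"

definition tww :: "'a graph \<Rightarrow> nat" where
  "tww G = (LEAST w. \<exists>Hs. contraction_sequence (trigraph_of G) Hs \<and> sequence_width Hs = w)"

definition connected_graph :: "'a graph \<Rightarrow> bool" where
  "connected_graph G \<longleftrightarrow> verts G \<noteq> {} \<and>
     (\<forall>u\<in>verts G. \<forall>v\<in>verts G. (u, v) \<in> {(a, b). {a, b} \<in> edges G}\<^sup>*)"

definition is_cycle :: "'a graph \<Rightarrow> 'a list \<Rightarrow> bool" where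
  "is_cycle G c \<longleftrightarrow> 3 \<le> length c \<and> distinct c \<and>
     (\<forall>i<length c. {c ! i, c ! (Suc i mod length c)} \<in> edges G)"

definition is_tree :: "'a graph \<Rightarrow> bool" where
  "is_tree T \<longleftrightarrow> simple_graph T \<and> connected_graph T \<and> (\<nexists>c. is_cycle T c)"

definition strong_tree_decomposition :: "'a graph \<Rightarrow> 'i graph \<Rightarrow> ('i \<Rightarrow> 'a set) \<Rightarrow> bool" where
  "strong_tree_decomposition G T B \<longleftrightarrow> is_tree T \<and>
     disjoint_family_on B (verts T) \<and> (\<Union>i\<in>verts T. B i) = verts G \<and>
     (\<forall>u v. {u, v} \<in> edges G \<longrightarrow>
        (\<exists>i\<in>verts T. u \<in> B i \<and> v \<in> B i) \<or>
        (\<exists>i j. {i, j} \<in> edges T \<and> u \<in> B i \<and> v \<in> B j))"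

definition decomposition_width :: "'i graph \<Rightarrow> ('i \<Rightarrow> 'a set) \<Rightarrow> nat" where
  "decomposition_width T B = Max ((\<lambda>i. card (B i)) ` verts T)"

text \<open>
  Since trees are finite, it is no restriction to take their nodes to be natural numbers.
\<close>

definition strong_tree_width :: "'a graph \<Rightarrow> nat" where
  "strong_tree_width G = (LEAST w. \<exists>(T :: nat graph) B.
     strong_tree_decomposition G T B \<and> decomposition_width T B = w)"

lemma is_trigraph_trigraph_of: "simple_graph G \<Longrightarrow> is_trigraph (trigraph_of G)"
  by (simp add: simple_graph_def is_trigraph_def trigraph_of_def)

lemma is_trigraph_contraction_step:
  assumes "is_trigraph H" and "contraction_step H H'"
  shows "is_trigraph H'"
proof -
  obtain x y z where xyz: "x \<in> tverts H" "y \<in> tverts H" "x \<noteq> y" "z \<notin> tverts H - {x, y}"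
    and H': "H' = contract H x y z"
    using assms(2) unfolding contraction_step_def by blast
  have fin: "finite (tverts H)" and disj: "black H \<inter> red H = {}"
    and sub: "\<And>e. e \<in> black H \<union> red H \<Longrightarrow> e \<subseteq> tverts H \<and> card e = 2"
    using assms(1) unfolding is_trigraph_def by auto
  have "z \<notin> e" if "e \<in> black H \<union> red H" "x \<notin> e" "y \<notin> e" for e
    using sub[OF that(1)] that(2,3) xyz(4) by blast
  then have "black H' \<inter> red H' = {}"
    using disj unfolding H' contract_def by (auto simp: doubleton_eq_iff)
  moreover have "black H' \<union> red H' \<subseteq> {e. e \<subseteq> tverts H' \<and> card e = 2}"
  proof
    fix e assume "e \<in> black H' \<union> red H'"
    then consider "e \<in> black H \<union> red H" "x \<notin> e" "y \<notin> e"
      | u where "e = {z, u}" "u \<in> tverts H - {x, y}"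
      unfolding H' contract_def by auto
    then show "e \<in> {e. e \<subseteq> tverts H' \<and> card e = 2}"
    proof cases
      case 1
      then show ?thesis using sub[OF 1(1)] unfolding H' contract_def by auto
    next
      case 2
      then have "z \<noteq> u" using xyz(4) by blast
      then show ?thesis using 2 unfolding H' contract_def by auto
    qed
  qed
  moreover have "finite (tverts H')"
    using fin unfolding H' contract_def by simp
  ultimately show ?thesis unfolding is_trigraph_def by blast
qed

end

theory Submission imports Defs begin

text \<open>
  Absorb the tree leaf by leaf into parent bags, keeping at most one extra vertex per bag. The bag
  of a leaf together with its extra vertex is a set of at most \<open>k + 1\<close> vertices without red edges
  to the parent bag \<open>P\<close>, and it is contracted to a single vertex as follows. While there are
  \<open>s \<ge> 2\<close> uncontracted vertices, averaging yields two of them whose neighbourhoods in \<open>P\<close> differ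
  in at most \<open>k s / (2 (s - 1))\<close> vertices. The others number at most \<open>(k + 1 + s) / 2 - 2\<close>, so
  the pair gets red degree at most \<open>(3 k - 1) / 2\<close>. Once \<open>s \<le> 1\<close>, at most \<open>(k + 2) / 2\<close> vertices
  remain, and even if all of them are red to each other and to \<open>P\<close> the red degree is at most
  \<open>3 k / 2\<close>. The vertices of \<open>P\<close> have red degree at most \<open>k + 2\<close> throughout. This gives
  \<open>tww G \<le> (3 k + 3) / 2\<close>, which is stronger than the claimed bound.
\<close>

section \<open>Combinatorial tools: averaging over pairs, leaves of forests\<close>

text \<open>If \<open>a\<close> of the \<open>s = card A\<close> elements are related to
  \<open>p\<close>, then \<open>2 a (s - a)\<close> ordered pairs disagree at \<open>p\<close>,
  which is at most \<open>s s / 2\<close>. Summing over \<open>P\<close> and averaging over the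
  \<open>s (s - 1)\<close> ordered pairs of distinct elements gives the bound, with denominators
  cleared to stay in \<open>nat\<close>.\<close>

lemma averaging_pair:
  fixes R :: "'a \<Rightarrow> 'b \<Rightarrow> bool"
  assumes A: "finite A" "2 \<le> card A" and P: "finite P" "card P \<le> k"
  obtains x y where "x \<in> A" "y \<in> A" "x \<noteq> y"
    "2 * (card A - 1) * card {p \<in> P. R x p \<noteq> R y p} \<le> k * card A"
proof -
  define s where "s = card A"
  define D where "D x y = card {p \<in> P. R x p \<noteq> R y p}" for x y
  have "\<exists>x\<in>A. \<exists>y\<in>A. x \<noteq> y \<and> 2 * (s - 1) * D x y \<le> k * s"
  proof (rule ccontr)
    assume "\<not> ?thesis"
    then have big: "k * s + 1 \<le> 2 * (s - 1) * D x y" if "x \<in> A" "y \<in> A - {x}" for x y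
      using that by (metis DiffD1 DiffD2 Suc_eq_plus1 insertCI not_less_eq_eq)
    have col: "2 * (\<Sum>x\<in>A. card {y \<in> A. R x p \<noteq> R y p}) \<le> s * s" for p
    proof -
      define a where "a = card {y \<in> A. R y p}"
      have le: "a \<le> s" unfolding a_def s_def using A by (auto intro: card_mono)
      have "{y \<in> A. \<not> R y p} = A - {y \<in> A. R y p}" by blast
      then have c: "card {y \<in> A. \<not> R y p} = s - a"
        using A by (simp add: card_Diff_subset s_def a_def)
      have "(\<Sum>x\<in>A. card {y \<in> A. R x p \<noteq> R y p}) = (\<Sum>x\<in>A. if R x p then s - a else a)"
        using c by (intro sum.cong) (auto simp: a_def)
      also have "\<dots> = a * (s - a) + (s - a) * a"
        using A c by (simp add: sum.If_cases Int_def a_def)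
      finally have eq: "(\<Sum>x\<in>A. card {y \<in> A. R x p \<noteq> R y p}) = 2 * (a * (s - a))" by simp
      obtain b where b: "s = a + b" using le le_Suc_ex by blast
      \<comment> \<open>The square of \<open>a - b\<close> is nonnegative; the detour through
        \<open>int\<close> avoids truncated subtraction.\<close>
      have "4 * (a * b) \<le> (a + b) * (a + b)"
      proof -
        have "0 \<le> (int a - int b)\<^sup>2" by simp
        then have "int (4 * (a * b)) \<le> int ((a + b) * (a + b))"
          by (simp add: power2_eq_square algebra_simps)
        then show ?thesis by linarith
      qed
      then show ?thesis unfolding eq b by simp
    qed
    have D_sum: "D x y = (\<Sum>p\<in>P. if R x p \<noteq> R y p then 1 else 0)" for x y
      unfolding D_def using P by (simp add: sum.If_cases Int_def)
    have "(\<Sum>x\<in>A. \<Sum>y\<in>A. D x y) = (\<Sum>p\<in>P. \<Sum>x\<in>A. \<Sum>y\<in>A. if R x p \<noteq> R y p then 1 else 0)"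
      unfolding D_sum by (subst sum.swap[of _ A P], rule sum.cong, simp, rule sum.swap)
    also have "\<dots> = (\<Sum>p\<in>P. \<Sum>x\<in>A. card {y \<in> A. R x p \<noteq> R y p})"
      using A by (simp add: sum.If_cases Int_def)
    finally have "2 * (\<Sum>x\<in>A. \<Sum>y\<in>A. D x y) = (\<Sum>p\<in>P. 2 * (\<Sum>x\<in>A. card {y \<in> A. R x p \<noteq> R y p}))"
      by (simp add: sum_distrib_left)
    also have "\<dots> \<le> (\<Sum>p\<in>P. s * s)" by (rule sum_mono) (rule col)
    also have "\<dots> \<le> k * (s * s)" using P by simp
    finally have up: "2 * (\<Sum>x\<in>A. \<Sum>y\<in>A. D x y) \<le> k * (s * s)" .
    have "(\<Sum>x\<in>A. \<Sum>y\<in>A-{x}. k * s + 1) \<le> (\<Sum>x\<in>A. \<Sum>y\<in>A-{x}. 2 * (s - 1) * D x y)"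
      by (intro sum_mono big)
    also have "\<dots> \<le> (\<Sum>x\<in>A. \<Sum>y\<in>A. 2 * (s - 1) * D x y)"
      using A by (intro sum_mono sum_mono2) auto
    also have "\<dots> = (s - 1) * (2 * (\<Sum>x\<in>A. \<Sum>y\<in>A. D x y))"
      by (simp add: sum_distrib_left algebra_simps)
    also have "\<dots> \<le> (s - 1) * (k * (s * s))" using up by (rule mult_le_mono2)
    finally have "s * ((s - 1) * (k * s + 1)) \<le> (s - 1) * (k * (s * s))"
      using A by (simp add: s_def)
    then have "(s - 1) * s * (k * s + 1) \<le> (s - 1) * s * (k * s)"
      by (simp add: algebra_simps)
    moreover have "0 < (s - 1) * s" using A by (simp add: s_def)
    ultimately show False by simp
  qed
  then show thesis using that unfolding s_def D_def by blast
qed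

text \<open>Take \<open>i\<close> as the first vertex of a longest path inside \<open>N\<close>. By
  maximality its neighbours in \<open>N\<close> lie on the path, and any of them beyond the second
  vertex would close a cycle. \<open>N\<close> need not induce a connected graph, so
  \<open>i\<close> may also be isolated.\<close>

lemma forest_leaf:
  assumes T: "simple_graph T" and acyclic: "\<nexists>c. is_cycle T c"
    and N: "finite N" "2 \<le> card N"
  obtains i j where "i \<in> N" "j \<in> N" "i \<noteq> j" "\<And>l. l \<in> N \<Longrightarrow> {i, l} \<in> edges T \<Longrightarrow> l = j"
proof -
  define path where "path xs \<longleftrightarrow> distinct xs \<and> set xs \<subseteq> N \<and> xs \<noteq> [] \<and>
    (\<forall>m. Suc m < length xs \<longrightarrow> {xs ! m, xs ! Suc m} \<in> edges T)" for xs
  obtain v where "v \<in> N" using N by fastforce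
  then have "path [v]" by (simp add: path_def)
  moreover have "\<forall>xs. path xs \<longrightarrow> length xs < Suc (card N)"
    using N unfolding path_def by (metis card_mono distinct_card less_Suc_eq_le)
  ultimately have "\<exists>xs. path xs \<and> (\<forall>ys. path ys \<longrightarrow> length ys \<le> length xs)"
    by (rule ex_has_greatest_nat)
  then obtain xs where xs: "path xs" and max: "\<And>ys. path ys \<Longrightarrow> length ys \<le> length xs"
    by blast
  then have ne: "xs \<noteq> []" by (simp add: path_def)
  define i where "i = xs ! 0"
  have i: "i \<in> N" using xs ne unfolding path_def i_def by auto
  have nbr: "1 < length xs \<and> l = xs ! 1" if l: "l \<in> N" "{i, l} \<in> edges T" for l
  proof -
    have "l \<in> set xs"
    proof (rule ccontr)
      assume "l \<notin> set xs"
      moreover have "{(l # xs) ! m, (l # xs) ! Suc m} \<in> edges T" if "Suc m < length (l # xs)" for m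
        using that xs l unfolding path_def i_def by (cases m) (auto simp: insert_commute)
      ultimately have "path (l # xs)" using xs l unfolding path_def by auto
      from max[OF this] show False by simp
    qed
    then obtain m where m: "m < length xs" "l = xs ! m" by (metis in_set_conv_nth)
    have "i \<noteq> l" using T l(2) unfolding simple_graph_def by auto
    then have "m \<noteq> 0" using m unfolding i_def by metis
    moreover have "\<not> 2 \<le> m"
    proof
      assume m2: "2 \<le> m"
      \<comment> \<open>The prefix of the path up to \<open>l\<close> is closed by the edge between
        \<open>l\<close> and \<open>i\<close>.\<close>
      have "is_cycle T (take (Suc m) xs)"
        unfolding is_cycle_def
      proof (intro conjI allI impI)
        show "3 \<le> length (take (Suc m) xs)" using m m2 by simp
        show "distinct (take (Suc m) xs)" using xs by (simp add: path_def)
      next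
        fix a assume "a < length (take (Suc m) xs)"
        then have a: "a \<le> m" using m by simp
        have len: "length (take (Suc m) xs) = Suc m" using m by simp
        show "{take (Suc m) xs ! a, take (Suc m) xs ! (Suc a mod length (take (Suc m) xs))}
            \<in> edges T"
        proof (cases "a = m")
          case True
          then show ?thesis unfolding len using m l by (simp add: i_def insert_commute)
        next
          case False
          then show ?thesis unfolding len using a m xs by (simp add: path_def)
        qed
      qed
      then show False using acyclic by blast
    qed
    ultimately have "m = 1" by linarith
    then show ?thesis using m by simp
  qed
  show thesis
  proof (cases "1 < length xs")
    case True
    then have "xs ! 1 \<in> N" "i \<noteq> xs ! 1"
      using xs unfolding path_def i_def by (auto simp: nth_eq_iff_index_eq)
    then show thesis using that i nbr by blast
  next
    case False
    \<comment> \<open>Here \<open>i\<close> has no neighbour in \<open>N\<close>, so any other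
      element can serve as \<open>j\<close>.\<close>
    have "\<not> N \<subseteq> {i}" using N card_mono[of "{i}" N] by auto
    then obtain j where "j \<in> N" "j \<noteq> i" by blast
    then show thesis using that[of i j] i nbr False by blast
  qed
qed

section \<open>Contraction steps of bounded red degree and twin-width\<close>

definition bounded_red :: "nat \<Rightarrow> 'a trigraph \<Rightarrow> bool" where
  "bounded_red w H \<longleftrightarrow> (\<forall>v\<in>tverts H. red_degree H v \<le> w)"

text \<open>Only the target is bounded, so steps chain under the reflexive transitive closure and
  the bound on the start is checked once.\<close>

definition bounded_step :: "nat \<Rightarrow> 'a trigraph \<Rightarrow> 'a trigraph \<Rightarrow> bool" where
  "bounded_step w H H' \<longleftrightarrow> contraction_step H H' \<and> bounded_red w H'"

lemma card_contraction_step: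
  assumes "finite (tverts H)" and "contraction_step H H'"
  shows "finite (tverts H')" "card (tverts H) = Suc (card (tverts H'))"
proof -
  obtain x y z where xyz: "x \<in> tverts H" "y \<in> tverts H" "x \<noteq> y" "z \<notin> tverts H - {x, y}"
    and H': "H' = contract H x y z"
    using assms(2) unfolding contraction_step_def by blast
  have V: "tverts H' = insert z (tverts H - {x, y})" by (simp add: H' contract_def)
  show "finite (tverts H')" using assms(1) by (simp add: V)
  have "2 \<le> card (tverts H)"
    using xyz assms(1) card_mono[of "tverts H" "{x, y}"] by simp
  then show "card (tverts H) = Suc (card (tverts H'))"
    using xyz assms(1) unfolding V by (simp add: card_Diff_subset)
qed

text \<open>Each step loses exactly one vertex, so a chain ending in one vertex has the prescribed
  length. Finiteness is recorded for the \<open>Max\<close> in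
  \<open>sequence_width\<close>.\<close>

lemma contraction_sequence_of_steps:
  assumes "(bounded_step w)\<^sup>*\<^sup>* H H'" "finite (tverts H)" "bounded_red w H" "card (tverts H') = 1"
  shows "\<exists>Hs. contraction_sequence H Hs \<and> (\<forall>K\<in>set Hs. bounded_red w K \<and> finite (tverts K))"
  using assms
proof (induction rule: converse_rtranclp_induct)
  case base
  then show ?case by (intro exI[of _ "[H']"]) (simp add: contraction_sequence_def)
next
  case (step H K)
  then have HK: "contraction_step H K" "bounded_red w K" by (auto simp: bounded_step_def)
  note K = card_contraction_step[OF step.prems(1) HK(1)]
  obtain Hs where Hs: "contraction_sequence K Hs" "\<forall>K\<in>set Hs. bounded_red w K \<and> finite (tverts K)"
    using step.IH[OF K(1) HK(2) step.prems(3)] by blast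
  then have "contraction_sequence H (H # Hs)"
    using HK(1) K(2) unfolding contraction_sequence_def
    by (auto simp: nth_Cons hd_conv_nth split: nat.split)
  then show ?case using Hs(2) step.prems by (intro exI[of _ "H # Hs"]) simp
qed

lemma tww_le_of_steps:
  assumes "(bounded_step w)\<^sup>*\<^sup>* (trigraph_of G) H'" "simple_graph G" "card (tverts H') = 1"
  shows "tww G \<le> w"
proof -
  have "bounded_red w (trigraph_of G)" "finite (tverts (trigraph_of G))"
    using assms(2) by (auto simp: bounded_red_def red_degree_def trigraph_of_def simple_graph_def)
  then obtain Hs where Hs: "contraction_sequence (trigraph_of G) Hs"
      "\<forall>K\<in>set Hs. bounded_red w K \<and> finite (tverts K)"
    using contraction_sequence_of_steps[OF assms(1) _ _ assms(3)] by blast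
  define M where "M = {red_degree H v | H v. H \<in> set Hs \<and> v \<in> tverts H}"
  have "M = (\<Union>H\<in>set Hs. red_degree H ` tverts H)" unfolding M_def by blast
  then have "finite M" using Hs(2) by simp
  moreover have "Hs \<noteq> []" "card (tverts (last Hs)) = 1"
    using Hs(1) by (auto simp: contraction_sequence_def)
  then have "last Hs \<in> set Hs" "tverts (last Hs) \<noteq> {}" by auto
  then have "M \<noteq> {}" unfolding M_def by blast
  moreover have "\<forall>m\<in>M. m \<le> w" using Hs(2) by (auto simp: M_def bounded_red_def)
  ultimately have "sequence_width Hs \<le> w" unfolding sequence_width_def M_def[symmetric] by simp
  moreover have "tww G \<le> sequence_width Hs"
    unfolding tww_def by (rule Least_le) (use Hs(1) in blast)
  ultimately show ?thesis by linarith
qed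

section \<open>Contracting a set with a controlled boundary\<close>

definition red_nbrs :: "'a trigraph \<Rightarrow> 'a \<Rightarrow> 'a set" where
  "red_nbrs H v = {u \<in> tverts H. {v, u} \<in> red H}"

lemma red_degree_card: "red_degree H v = card (red_nbrs H v)"
  by (simp add: red_degree_def red_nbrs_def)

text \<open>\<open>S\<close> is the set to be contracted and \<open>P\<close> separates it from the
  rest, so contractions inside \<open>S\<close> can change red degrees only in \<open>S\<close> and
  \<open>P\<close>.\<close>

definition confined :: "'a trigraph \<Rightarrow> 'a set \<Rightarrow> 'a set \<Rightarrow> bool" where
  "confined H S P \<longleftrightarrow> S \<subseteq> tverts H \<and> P \<subseteq> tverts H - S \<and>
     (\<forall>u v. {u, v} \<in> black H \<union> red H \<longrightarrow> u \<in> S \<longrightarrow> v \<in> S \<union> P)"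

definition agree_off :: "'a set \<Rightarrow> 'a trigraph \<Rightarrow> 'a trigraph \<Rightarrow> bool" where
  "agree_off S H H' \<longleftrightarrow> tverts H' - S = tverts H - S \<and>
     (\<forall>e. e \<inter> S = {} \<longrightarrow> (e \<in> black H' \<longleftrightarrow> e \<in> black H) \<and> (e \<in> red H' \<longleftrightarrow> e \<in> red H))"

lemma agree_off_trans:
  assumes "agree_off S H K" "agree_off S' K L" "S' \<subseteq> S"
  shows "agree_off S H L"
  unfolding agree_off_def
proof (intro conjI allI impI)
  show "tverts L - S = tverts H - S" using assms unfolding agree_off_def by blast
  fix e assume e: "e \<inter> S = {}"
  then have "e \<inter> S' = {}" using assms(3) by blast
  then show "e \<in> black L \<longleftrightarrow> e \<in> black H" "e \<in> red L \<longleftrightarrow> e \<in> red H"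
    using e assms(1,2) unfolding agree_off_def by simp_all
qed

lemma agree_off_red_nbrs:
  assumes "agree_off S H H'" "v \<notin> S"
  shows "red_nbrs H' v - S = red_nbrs H v - S"
proof -
  have "u \<in> tverts H' \<longleftrightarrow> u \<in> tverts H" "{v, u} \<in> red H' \<longleftrightarrow> {v, u} \<in> red H" if "u \<notin> S" for u
    using assms that unfolding agree_off_def by (blast, simp)
  then show ?thesis unfolding red_nbrs_def by blast
qed

text \<open>The merged vertex reuses the name \<open>x\<close>, so \<open>S\<close> merely loses
  \<open>y\<close> and no new names arise. A red edge from \<open>x\<close> into \<open>P\<close> is
  either inherited from \<open>x\<close> or \<open>y\<close> or caused by a disagreement of their
  black neighbourhoods; other vertices of \<open>S\<close> keep their edges to
  \<open>P\<close>.\<close>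

lemma contract_into:
  assumes H: "is_trigraph H" and conf: "confined H S P" and x: "x \<in> S" and y: "y \<in> S" "x \<noteq> y"
  defines "H' \<equiv> contract H x y x"
  shows "contraction_step H H'" "is_trigraph H'" "tverts H' = tverts H - {y}" "agree_off S H H'"
    "confined H' (S - {y}) P"
    "v \<in> S - {x, y} \<Longrightarrow> red_nbrs H' v \<inter> P = red_nbrs H v \<inter> P"
    "red_nbrs H' x \<inter> P \<subseteq> red_nbrs H x \<inter> P \<union> red_nbrs H y \<inter> P \<union>
       {p \<in> P. ({x, p} \<in> black H) \<noteq> ({y, p} \<in> black H)}"
proof -
  have SV: "S \<subseteq> tverts H" "P \<subseteq> tverts H - S" using conf by (auto simp: confined_def)
  show step: "contraction_step H H'"
    unfolding contraction_step_def H'_def using x y SV by blast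
  show "is_trigraph H'" using is_trigraph_contraction_step[OF H step] .
  show V: "tverts H' = tverts H - {y}" using x y SV by (auto simp: H'_def contract_def)
  show "agree_off S H H'"
    unfolding agree_off_def V using x y by (auto simp: H'_def contract_def)
  show "v \<in> S - {x, y} \<Longrightarrow> red_nbrs H' v \<inter> P = red_nbrs H v \<inter> P"
    using x y SV unfolding red_nbrs_def V by (auto simp: H'_def contract_def doubleton_eq_iff)
  show "red_nbrs H' x \<inter> P \<subseteq> red_nbrs H x \<inter> P \<union> red_nbrs H y \<inter> P \<union>
       {p \<in> P. ({x, p} \<in> black H) \<noteq> ({y, p} \<in> black H)}"
    using x y SV unfolding red_nbrs_def V by (auto simp: H'_def contract_def doubleton_eq_iff)
  have nb: "v \<in> S \<union> P" if "{u, v} \<in> black H \<or> {u, v} \<in> red H" "u \<in> S" for u v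
    using conf that unfolding confined_def by blast
  have "v \<in> S - {y} \<union> P" if e: "{u, v} \<in> black H' \<union> red H'" and u: "u \<in> S - {y}" for u v
  proof -
    \<comment> \<open>An edge of \<open>H'\<close> is an old edge avoiding \<open>y\<close>, or an
      edge at \<open>x\<close> inherited from \<open>x\<close> or \<open>y\<close>.\<close>
    have "({u, v} \<in> black H \<or> {u, v} \<in> red H) \<and> v \<noteq> y \<or>
      (\<exists>w. {u, v} = {x, w} \<and> w \<noteq> y \<and>
        ({x, w} \<in> black H \<or> {x, w} \<in> red H \<or> {y, w} \<in> black H \<or> {y, w} \<in> red H))"
      using e unfolding H'_def contract_def by auto
    then show ?thesis
    proof
      assume "({u, v} \<in> black H \<or> {u, v} \<in> red H) \<and> v \<noteq> y"
      then show ?thesis using nb u by blast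
    next
      assume "\<exists>w. {u, v} = {x, w} \<and> w \<noteq> y \<and>
        ({x, w} \<in> black H \<or> {x, w} \<in> red H \<or> {y, w} \<in> black H \<or> {y, w} \<in> red H)"
      then obtain w where w: "{u, v} = {x, w}" "w \<noteq> y" "w \<in> S \<union> P" using nb x y by blast
      then show ?thesis using x y by (auto simp: doubleton_eq_iff)
    qed
  qed
  then show "confined H' (S - {y}) P" using SV y unfolding confined_def V by blast
qed

text \<open>Confinement splits the check in three: a vertex of \<open>S\<close> sees red only in the
  rest of \<open>S\<close> and in \<open>P\<close>, a vertex of \<open>P\<close> is charged for all
  of \<open>S\<close>, and any other vertex has no red neighbour in \<open>S\<close>.\<close>

lemma bounded_red_confined:
  assumes H: "is_trigraph H" and conf: "confined H S P"
    and S: "\<And>v. v \<in> S \<Longrightarrow> card S - 1 + card (red_nbrs H v \<inter> P) \<le> w"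
    and P: "\<And>v. v \<in> P \<Longrightarrow> card (red_nbrs H v - S) + card S \<le> w"
    and rest: "\<And>v. v \<in> tverts H - S - P \<Longrightarrow> card (red_nbrs H v - S) \<le> w"
  shows "bounded_red w H"
  unfolding bounded_red_def red_degree_card
proof
  fix v assume v: "v \<in> tverts H"
  have fin: "finite (tverts H)" using H by (simp add: is_trigraph_def)
  then have finS: "finite S" "finite P" using conf finite_subset[of _ "tverts H"] unfolding confined_def by auto
  have finR: "finite (red_nbrs H v)" using fin by (simp add: red_nbrs_def)
  have nb: "u \<in> S \<union> P" if "{v', u} \<in> red H" "v' \<in> S" for u v'
    using conf that unfolding confined_def by blast
  have irr: "v \<notin> red_nbrs H v" using H unfolding is_trigraph_def red_nbrs_def by auto
  consider "v \<in> S" | "v \<in> P" | "v \<in> tverts H - S - P" using v by blast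
  then show "card (red_nbrs H v) \<le> w"
  proof cases
    case 1
    then have "red_nbrs H v \<subseteq> (S - {v}) \<union> (red_nbrs H v \<inter> P)"
      using nb irr unfolding red_nbrs_def by auto
    then have "card (red_nbrs H v) \<le> card ((S - {v}) \<union> (red_nbrs H v \<inter> P))"
      using finS by (intro card_mono) auto
    also have "\<dots> \<le> card (S - {v}) + card (red_nbrs H v \<inter> P)" by (rule card_Un_le)
    finally show ?thesis using S[OF 1] 1 finS by simp
  next
    case 2
    have "card (red_nbrs H v) \<le> card ((red_nbrs H v - S) \<union> S)"
      using finS finR by (intro card_mono) auto
    also have "\<dots> \<le> card (red_nbrs H v - S) + card S" by (rule card_Un_le)
    finally show ?thesis using P[OF 2] by simp
  next
    case 3
    have "red_nbrs H v - S = red_nbrs H v"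
      using 3 nb by (fastforce simp: red_nbrs_def insert_commute)
    then show ?thesis using rest[OF 3] by simp
  qed
qed

text \<open>
  \<open>A\<close> consists of the vertices of \<open>S\<close> that have not been contracted yet, so each vertex of
  \<open>S - A\<close> stands for two or more vertices. As long as \<open>A\<close> has two vertices, contract a pair of
  them with few disagreements on \<open>P\<close>; afterwards \<open>S\<close> is so small that every pair will do.
\<close>

lemma contract_confined:
  assumes "is_trigraph H" "confined H S P" "card P \<le> k" "3 * k \<le> 2 * w"
    and "\<And>v. v \<in> S \<Longrightarrow> card S - 1 + card (red_nbrs H v \<inter> P) \<le> w"
    and "\<And>v. v \<in> P \<Longrightarrow> card (red_nbrs H v - S) + card S \<le> w"
    and "\<And>v. v \<in> tverts H - S - P \<Longrightarrow> card (red_nbrs H v - S) \<le> w"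
    and "card S + k \<le> w + 1 \<or>
      (A \<subseteq> S \<and> (\<forall>v\<in>A. red_nbrs H v \<inter> P = {}) \<and> card A + 2 * card (S - A) \<le> k + 1)"
  shows "\<exists>H' S'. (bounded_step w)\<^sup>*\<^sup>* H H' \<and> is_trigraph H' \<and> bounded_red w H' \<and> agree_off S H H' \<and>
    S' \<subseteq> S \<and> card S' \<le> 1 \<and> (S' = {} \<longrightarrow> S = {}) \<and> tverts H' = tverts H - S \<union> S' \<and>
    confined H' S' P"
  using assms
proof (induction "card S" arbitrary: H S A rule: less_induct)
  case less
  have fin: "finite (tverts H)" using less.prems(1) by (simp add: is_trigraph_def)
  have SV: "S \<subseteq> tverts H" "P \<subseteq> tverts H - S" using less.prems(2) by (auto simp: confined_def)
  then have finS: "finite S" "finite P" using fin finite_subset by blast+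
  show ?case
  proof (cases "card S \<le> 1")
    case True
    have "bounded_red w H"
      by (rule bounded_red_confined[OF less.prems(1,2,5,6,7)])
    then show ?thesis using True less.prems(1,2) SV
      by (intro exI[of _ H] exI[of _ S]) (auto simp: agree_off_def)
  next
    case False
    \<comment> \<open>In this regime a vertex of \<open>S\<close> may be red to all of
      \<open>S\<close> and \<open>P\<close> without exceeding \<open>w\<close>.\<close>
    define small where "small \<longleftrightarrow> card S + k \<le> w + 1"
    \<comment> \<open>Contracted vertices have weight two, so merging two vertices of
      \<open>A\<close> leaves the weighted count unchanged.\<close>
    define fresh where "fresh H S A \<longleftrightarrow>
      A \<subseteq> S \<and> (\<forall>v\<in>A. red_nbrs H v \<inter> P = {}) \<and> card A + 2 * card (S - A) \<le> k + 1" for H S A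
    have "\<exists>x\<in>S. \<exists>y\<in>S. \<exists>A'. x \<noteq> y \<and>
      card (S - {y}) - 1 + card (red_nbrs (contract H x y x) x \<inter> P) \<le> w \<and>
      (card (S - {y}) + k \<le> w + 1 \<or> fresh (contract H x y x) (S - {y}) A')"
    proof (cases small)
      case True
      obtain x y where xy: "x \<in> S" "y \<in> S" "x \<noteq> y"
        using False finS by (metis card_le_Suc0_iff_eq One_nat_def)
      have "card (S - {y}) = card S - 1" using xy finS by simp
      moreover have "card (red_nbrs (contract H x y x) x \<inter> P) \<le> k"
        using less.prems(3) finS card_mono[of P "red_nbrs (contract H x y x) x \<inter> P"] by simp
      ultimately show ?thesis using xy True False unfolding small_def
        by (intro bexI[of _ x] bexI[of _ y]) auto
    next
      case notsmall: False
      then have A: "A \<subseteq> S" "\<forall>v\<in>A. red_nbrs H v \<inter> P = {}" "card A + 2 * card (S - A) \<le> k + 1"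
        using less.prems(8) by (auto simp: small_def)
      have finA: "finite A" using A(1) finS finite_subset by blast
      have cS: "card S = card A + card (S - A)"
        using A(1) finA finS by (metis card_Diff_subset card_mono le_add_diff_inverse)
      \<comment> \<open>With \<open>card A\<close> at most 1, the weighted count gives
        \<open>2 * card S \<le> k + 2\<close>, hence
        \<open>2 * (card S + k) \<le> 3 * k + 2 \<le> 2 * w + 2\<close>, which is the case
        \<open>small\<close>.\<close>
      have A2: "2 \<le> card A"
        using notsmall A(3) cS less.prems(4) unfolding small_def by linarith
      obtain x y where xy: "x \<in> A" "y \<in> A" "x \<noteq> y" and avg:
        "2 * (card A - 1) * card {p \<in> P. ({x, p} \<in> black H) \<noteq> ({y, p} \<in> black H)} \<le> k * card A"
        using averaging_pair[OF finA A2 finS(2) less.prems(3), of "\<lambda>x p. {x, p} \<in> black H"] by blast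
      define D where "D = card {p \<in> P. ({x, p} \<in> black H) \<noteq> ({y, p} \<in> black H)}"
      define a where "a = card A - 1"
      have a: "1 \<le> a" "a \<le> k" "card A = a + 1" using A2 A(3) by (auto simp: a_def)
      \<comment> \<open>This makes the averaging bound linear: \<open>a (2 k + 1)\<close> exceeds
        \<open>k (a + 1) + a a\<close> by \<open>(a - 1) (k - a)\<close>, which is nonnegative for
        \<open>a\<close> between 1 and \<open>k\<close>; then \<open>a\<close> is cancelled.\<close>
      have Dle: "2 * D + a \<le> 2 * k + 1"
      proof -
        obtain b where b: "k = a + b" using a(2) le_Suc_ex by blast
        obtain c where c: "a = 1 + c" using a(1) le_Suc_ex by blast
        have "2 * a * D \<le> k * (a + 1)" using avg a unfolding D_def a_def by simp
        moreover have "k * (a + 1) + a * a \<le> a * (2 * k + 1)"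
          unfolding b c by (simp add: algebra_simps)
        ultimately have "a * (2 * D + a) \<le> a * (2 * k + 1)" by (simp add: algebra_simps)
        then show ?thesis unfolding mult_le_cancel1 using a(1) by linarith
      qed
      have xyS: "x \<in> S" "y \<in> S" using xy A(1) by auto
      note con = contract_into[OF less.prems(1,2) xyS xy(3)]
      have "red_nbrs (contract H x y x) x \<inter> P \<subseteq> {p \<in> P. ({x, p} \<in> black H) \<noteq> ({y, p} \<in> black H)}"
        using con(7) A(2) xy by blast
      then have "card (red_nbrs (contract H x y x) x \<inter> P) \<le> D"
        unfolding D_def using finS by (intro card_mono) auto
      moreover have cy: "card (S - {y}) = card S - 1" using xyS finS by simp
      \<comment> \<open>Since \<open>2 * card S \<le> a + k + 2\<close> and
        \<open>2 * D \<le> 2 * k + 1 - a\<close>, the \<open>a\<close> cancels and twice the left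
        side is at most \<open>3 * k - 1\<close>.\<close>
      ultimately have "card (S - {y}) - 1 + card (red_nbrs (contract H x y x) x \<inter> P) \<le> w"
        using cS A(3) a Dle less.prems(4) False by linarith
      moreover have "fresh (contract H x y x) (S - {y}) (A - {x, y})"
      proof -
        have "S - {y} - (A - {x, y}) = insert x (S - A)" using xy A(1) by blast
        then have "card (S - {y} - (A - {x, y})) = Suc (card (S - A))" using xy finS by simp
        moreover have "card (A - {x, y}) = card A - 2" using xy finA by simp
        moreover have "red_nbrs (contract H x y x) v \<inter> P = {}" if "v \<in> A - {x, y}" for v
          using con(6)[of v] that A(1,2) by auto
        ultimately show ?thesis
          using A(1,3) A2 xy unfolding fresh_def by auto
      qed
      ultimately show ?thesis using xyS xy(3) by blast
    qed
    then obtain x y A' where xy: "x \<in> S" "y \<in> S" "x \<noteq> y"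
      and bx: "card (S - {y}) - 1 + card (red_nbrs (contract H x y x) x \<inter> P) \<le> w"
      and A': "card (S - {y}) + k \<le> w + 1 \<or> fresh (contract H x y x) (S - {y}) A'" by blast
    define K where "K = contract H x y x"
    define S1 where "S1 = S - {y}"
    note con = contract_into[OF less.prems(1,2) xy, folded K_def S1_def]
    have cS: "card S1 < card S" "card S1 = card S - 1"
      using xy finS False unfolding S1_def by auto
    have S1: "card S1 - 1 + card (red_nbrs K v \<inter> P) \<le> w" if "v \<in> S1" for v
    proof (cases "v = x")
      case True
      then show ?thesis using bx by (simp add: K_def S1_def)
    next
      case False
      then have "v \<in> S - {x, y}" using that by (auto simp: S1_def)
      then show ?thesis using con(6)[of v] less.prems(5)[of v] cS by auto
    qed
    \<comment> \<open>A vertex outside \<open>S\<close> gains or loses red neighbours only inside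
      \<open>S\<close>, so the bounds for \<open>P\<close> and for the rest carry over as
      \<open>card S\<close> drops.\<close>
    have nbrs: "red_nbrs K v - S1 = red_nbrs H v - S" if "v \<notin> S" for v
    proof -
      have "y \<notin> red_nbrs K v" by (simp add: red_nbrs_def con(3))
      then have "red_nbrs K v - S1 = red_nbrs K v - S" by (auto simp: S1_def)
      then show ?thesis using agree_off_red_nbrs[OF con(4) that] by simp
    qed
    have P1: "card (red_nbrs K v - S1) + card S1 \<le> w" if "v \<in> P" for v
      using nbrs[of v] less.prems(6)[OF that] cS that SV by auto
    have R1: "card (red_nbrs K v - S1) \<le> w" if "v \<in> tverts K - S1 - P" for v
    proof -
      have "v \<in> tverts H - S - P" using that by (auto simp: con(3) S1_def)
      then show ?thesis using nbrs[of v] less.prems(7)[of v] by auto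
    qed
    have "bounded_red w K" by (rule bounded_red_confined[OF con(2,5) S1 P1 R1])
    then have step: "bounded_step w H K" using con(1) by (simp add: bounded_step_def)
    have "\<exists>H' S'. (bounded_step w)\<^sup>*\<^sup>* K H' \<and> is_trigraph H' \<and> bounded_red w H' \<and>
      agree_off S1 K H' \<and> S' \<subseteq> S1 \<and> card S' \<le> 1 \<and> (S' = {} \<longrightarrow> S1 = {}) \<and>
      tverts H' = tverts K - S1 \<union> S' \<and> confined H' S' P"
      by (rule less.hyps[OF cS(1) con(2,5) less.prems(3,4) S1 P1 R1 A'[folded K_def S1_def, unfolded fresh_def]])
    then obtain H' S' where H': "(bounded_step w)\<^sup>*\<^sup>* K H'" "is_trigraph H'" "bounded_red w H'"
      "agree_off S1 K H'" "S' \<subseteq> S1" "card S' \<le> 1" "S' = {} \<longrightarrow> S1 = {}"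
      "tverts H' = tverts K - S1 \<union> S'" "confined H' S' P"
      by (elim exE conjE)
    have "tverts H' = tverts H - S \<union> S'" using H'(8) SV xy by (auto simp: con(3) S1_def)
    moreover have "agree_off S H H'"
      using agree_off_trans[OF con(4) H'(4)] by (auto simp: S1_def)
    moreover have "S' \<noteq> {}" "S' \<subseteq> S" using xy H'(5,7) by (auto simp: S1_def)
    moreover have "(bounded_step w)\<^sup>*\<^sup>* H H'"
      using step H'(1) by (rule converse_rtranclp_into_rtranclp)
    ultimately show ?thesis using H'(2,3,6,9) by (intro exI[of _ H'] exI[of _ S'] conjI) simp_all
  qed
qed

section \<open>Absorbing a forest leaf by leaf\<close>

text \<open>
  The graph that is left after a part of the forest has been absorbed: a vertex \<open>v \<notin> C\<close> lies in
  the bag of the node \<open>f v \<in> N\<close>, and \<open>v \<in> C\<close> stands for everything that has been absorbed below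
  the node \<open>f v\<close>.
\<close>

definition layout :: "nat \<Rightarrow> 'i set \<Rightarrow> 'i set set \<Rightarrow> ('a \<Rightarrow> 'i) \<Rightarrow> 'a set \<Rightarrow> 'a trigraph \<Rightarrow> bool" where
  "layout k N E f C H \<longleftrightarrow> is_trigraph H \<and> tverts H \<noteq> {} \<and> f ` tverts H \<subseteq> N \<and>
     (\<forall>i\<in>N. card {v \<in> tverts H - C. f v = i} \<le> k \<and> card {v \<in> tverts H \<inter> C. f v = i} \<le> 1) \<and>
     (\<forall>u v. {u, v} \<in> red H \<longrightarrow> f u = f v \<and> (u \<in> C \<or> v \<in> C)) \<and>
     (\<forall>u v. {u, v} \<in> black H \<longrightarrow> f u = f v \<or> u \<notin> C \<and> v \<notin> C \<and> {f u, f v} \<in> E)"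

lemma layout_fibre:
  assumes "layout k N E f C H" "i \<in> N"
  shows "card {v \<in> tverts H. f v = i} \<le> k + 1"
proof -
  have "{v \<in> tverts H. f v = i} = {v \<in> tverts H - C. f v = i} \<union> {v \<in> tverts H \<inter> C. f v = i}" by blast
  then show ?thesis
    using assms card_Un_le[of "{v \<in> tverts H - C. f v = i}" "{v \<in> tverts H \<inter> C. f v = i}"]
    unfolding layout_def by fastforce
qed

text \<open>The red edges at a node form a star centred at its only vertex in \<open>C\<close>,
  whose other ends are among the at most \<open>k\<close> vertices of the bag.\<close>

lemma layout_red_nbrs:
  assumes "layout k N E f C H" "v \<in> tverts H"
  shows "v \<notin> C \<Longrightarrow> card (red_nbrs H v) \<le> 1" "1 \<le> k \<Longrightarrow> card (red_nbrs H v) \<le> k"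
proof -
  have fin: "finite (tverts H)" using assms(1) by (simp add: layout_def is_trigraph_def)
  have red: "f u = f v" "u \<in> C \<or> v \<in> C" "u \<in> tverts H" "u \<noteq> v" if "u \<in> red_nbrs H v" for u
    using assms(1) that unfolding layout_def red_nbrs_def is_trigraph_def by auto
  have card: "card {u \<in> tverts H - C. f u = f v} \<le> k" "card {u \<in> tverts H \<inter> C. f u = f v} \<le> 1"
    using assms unfolding layout_def by auto
  show one: "card (red_nbrs H v) \<le> 1" if "v \<notin> C"
  proof -
    have "red_nbrs H v \<subseteq> {u \<in> tverts H \<inter> C. f u = f v}" using red that by blast
    then show ?thesis using card(2) fin card_mono[of "{u \<in> tverts H \<inter> C. f u = f v}" "red_nbrs H v"]
      by simp
  qed
  show "card (red_nbrs H v) \<le> k" if "1 \<le> k"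
  proof (cases "v \<in> C")
    case True
    have "red_nbrs H v \<subseteq> {u \<in> tverts H - C. f u = f v}"
    proof
      fix u assume u: "u \<in> red_nbrs H v"
      have "u \<notin> C"
      proof
        assume "u \<in> C"
        then have "{u, v} \<subseteq> {u \<in> tverts H \<inter> C. f u = f v}" using True red[OF u] assms(2) by blast
        then have "card {u, v} \<le> 1"
          using card(2) fin card_mono[of "{u \<in> tverts H \<inter> C. f u = f v}" "{u, v}"] by simp
        then show False using red(4)[OF u] by simp
      qed
      then show "u \<in> {u \<in> tverts H - C. f u = f v}" using red[OF u] by blast
    qed
    then show ?thesis using card(1) fin card_mono[of "{u \<in> tverts H - C. f u = f v}" "red_nbrs H v"]
      by simp
  next
    case False
    then show ?thesis using one that by linarith
  qed
qed

text \<open>Two rounds of \<open>contract_confined\<close>: first everything at the leaf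
  \<open>i\<close> shrinks to at most one vertex, then that vertex is merged with the extra vertex
  of \<open>j\<close>, so that \<open>j\<close> again has at most one. In both rounds the boundary
  is the bag of \<open>j\<close> without its extra vertex, because black edges between different
  nodes avoid \<open>C\<close>. Empty bags are covered, as a round may take no steps.\<close>

lemma layout_absorb:
  assumes lay: "layout k N E f C H" and k: "1 \<le> k" and w: "3 * k \<le> 2 * w" "k + 2 \<le> w"
    and ij: "i \<in> N" "j \<in> N" "i \<noteq> j" and leaf: "\<And>l. l \<in> N \<Longrightarrow> {i, l} \<in> E \<Longrightarrow> l = j"
  shows "\<exists>H' f' C'. (bounded_step w)\<^sup>*\<^sup>* H H' \<and> layout k (N - {i}) E f' C' H'"
proof -
  define S where "S = {v \<in> tverts H. f v = i}"
  define P where "P = {v \<in> tverts H - C. f v = j}"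
  define Q where "Q = {v \<in> tverts H \<inter> C. f v = j}"
  have H: "is_trigraph H" "tverts H \<noteq> {}" "f ` tverts H \<subseteq> N" using lay by (auto simp: layout_def)
  have fin: "finite (tverts H)" using H by (simp add: is_trigraph_def)
  have cP: "card P \<le> k" and cQ: "card Q \<le> 1" using lay ij unfolding layout_def P_def Q_def by blast+
  have fins: "finite S" "finite P" "finite Q" using fin by (auto simp: S_def P_def Q_def)
  have cS: "card S \<le> k + 1" unfolding S_def by (rule layout_fibre[OF lay ij(1)])
  have red: "f u = f v" "u \<in> C \<or> v \<in> C" if "{u, v} \<in> red H" for u v
    using lay that unfolding layout_def by blast+
  have black: "f u = f v \<or> u \<notin> C \<and> v \<notin> C \<and> {f u, f v} \<in> E" if "{u, v} \<in> black H" for u v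
    using lay that unfolding layout_def by blast
  have ends: "u \<in> tverts H" "v \<in> tverts H" if "{u, v} \<in> black H \<union> red H" for u v
    using H(1) that unfolding is_trigraph_def by auto
  have conf: "confined H S P"
    unfolding confined_def
  proof (intro conjI allI impI)
    show "S \<subseteq> tverts H" "P \<subseteq> tverts H - S" using ij by (auto simp: S_def P_def)
    fix u v assume e: "{u, v} \<in> black H \<union> red H" and u: "u \<in> S"
    have fu: "f u = i" using u by (simp add: S_def)
    have v: "v \<in> tverts H" "f v \<in> N" using ends(2)[OF e] H(3) by auto
    show "v \<in> S \<union> P"
    proof (cases "f v = i")
      case True
      then show ?thesis using v by (simp add: S_def)
    next
      case False
      then have "{u, v} \<in> black H" using e red(1) fu by force
      then have "v \<notin> C" "{i, f v} \<in> E" using black False fu by force+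
      then show ?thesis using leaf v by (simp add: P_def)
    qed
  qed
  \<comment> \<open>Red edges never leave a node, so all of \<open>S\<close> can start as
    uncontracted vertices in the first round.\<close>
  have SP: "red_nbrs H v \<inter> P = {}" if "v \<in> S" for v
    using that ij red(1) by (fastforce simp: S_def P_def red_nbrs_def)
  have bS: "card S - 1 + card (red_nbrs H v \<inter> P) \<le> w" if "v \<in> S" for v
    using SP[OF that] cS w by simp
  have card_less: "card (red_nbrs H v - X) \<le> card (red_nbrs H v)" for v X
    using fin by (intro card_mono) (auto simp: red_nbrs_def)
  \<comment> \<open>This is where \<open>k + 2\<close> comes from: one red neighbour at node
    \<open>j\<close>, plus at most \<open>k + 1\<close> vertices of \<open>S\<close>.\<close>
  have bP: "card (red_nbrs H v - S) + card S \<le> w" if "v \<in> P" for v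
  proof -
    have "card (red_nbrs H v) \<le> 1" using that by (intro layout_red_nbrs[OF lay]) (auto simp: P_def)
    then show ?thesis using card_less[of v S] cS w by linarith
  qed
  have bR: "card (red_nbrs H v - S) \<le> w" if "v \<in> tverts H - S - P" for v
    using layout_red_nbrs(2)[OF lay _ k, of v] that card_less[of v S] w by auto
  have fresh: "card S + k \<le> w + 1 \<or>
      (S \<subseteq> S \<and> (\<forall>v\<in>S. red_nbrs H v \<inter> P = {}) \<and> card S + 2 * card (S - S) \<le> k + 1)"
    using SP cS by simp
  have "\<exists>H' S'. (bounded_step w)\<^sup>*\<^sup>* H H' \<and> is_trigraph H' \<and> bounded_red w H' \<and> agree_off S H H' \<and>
    S' \<subseteq> S \<and> card S' \<le> 1 \<and> (S' = {} \<longrightarrow> S = {}) \<and> tverts H' = tverts H - S \<union> S' \<and>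
    confined H' S' P"
    by (rule contract_confined[OF H(1) conf cP w(1) bS bP bR fresh])
  then obtain K S1 where K: "(bounded_step w)\<^sup>*\<^sup>* H K" "is_trigraph K" "bounded_red w K"
    "agree_off S H K" "S1 \<subseteq> S" "card S1 \<le> 1" "S1 = {} \<longrightarrow> S = {}"
    "tverts K = tverts H - S \<union> S1" "confined K S1 P"
    by (elim exE conjE)
  \<comment> \<open>Second round: the remnant of the leaf and the extra vertex of \<open>j\<close>,
    at most two vertices.\<close>
  define S2 where "S2 = S1 \<union> Q"
  have QS: "Q \<inter> S = {}" "P \<inter> S = {}" "Q \<inter> P = {}" using ij by (auto simp: Q_def S_def P_def)
  have redK: "{u, v} \<in> red K \<longleftrightarrow> {u, v} \<in> red H" and blackK: "{u, v} \<in> black K \<longleftrightarrow> {u, v} \<in> black H"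
    if "u \<notin> S" "v \<notin> S" for u v
    using K(4) that unfolding agree_off_def by auto
  have endsK: "u \<in> tverts K" "v \<in> tverts K" if "{u, v} \<in> black K \<union> red K" for u v
    using K(2) that unfolding is_trigraph_def by auto
  have notS: "u \<notin> S" if "u \<in> tverts K" "u \<notin> S1" for u using that K(8) by auto
  have confK1: "v \<in> S1 \<union> P" if "{u, v} \<in> black K \<union> red K" "u \<in> S1" for u v
    using K(9) that unfolding confined_def by blast
  have conf2: "confined K S2 P"
    unfolding confined_def
  proof (intro conjI allI impI)
    show "S2 \<subseteq> tverts K" using K(8) QS by (auto simp: S2_def Q_def)
    show "P \<subseteq> tverts K - S2" using K(5,8) QS by (auto simp: S2_def P_def)
    fix u v assume e: "{u, v} \<in> black K \<union> red K" and u: "u \<in> S2"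
    show "v \<in> S2 \<union> P"
    proof (cases "u \<in> S1 \<or> v \<in> S1")
      case True
      then show ?thesis using confK1 e by (auto simp: S2_def)
    next
      case False
      then have uQ: "u \<in> Q" using u by (simp add: S2_def)
      have nS: "u \<notin> S" "v \<notin> S" using False notS endsK[OF e] by auto
      then have eH: "{u, v} \<in> black H \<union> red H" using e redK blackK by auto
      have "f v = f u" using eH uQ red(1)[of u v] black[of u v] by (auto simp: Q_def)
      then show ?thesis using ends[OF eH] uQ by (auto simp: S2_def Q_def P_def)
    qed
  qed
  have finK: "finite (tverts K)" using K(2) by (simp add: is_trigraph_def)
  have finS2: "finite S2" using K(5) fins finite_subset by (auto simp: S2_def)
  have cS2: "card S2 \<le> 2" using card_Un_le[of S1 Q] K(6) cQ by (simp add: S2_def)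
  have bS2: "card S2 - 1 + card (red_nbrs K v \<inter> P) \<le> w" if "v \<in> S2" for v
    using cS2 cP w card_mono[OF fins(2), of "red_nbrs K v \<inter> P"] by simp
  \<comment> \<open>A red edge of \<open>K\<close> at \<open>v\<close> that avoids \<open>S\<close>
    was red in \<open>H\<close>, so its other end is the extra vertex of \<open>j\<close>, which
    lies in \<open>S2\<close>.\<close>
  have bP2: "card (red_nbrs K v - S2) + card S2 \<le> w" if v: "v \<in> P" for v
  proof -
    have "red_nbrs K v - S2 = {}"
    proof (rule ccontr)
      assume "red_nbrs K v - S2 \<noteq> {}"
      then obtain u where u: "u \<in> tverts K" "{v, u} \<in> red K" "u \<notin> S2" by (auto simp: red_nbrs_def)
      have "u \<notin> S" "v \<notin> S" using u notS v QS by (auto simp: S2_def)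
      then have "{v, u} \<in> red H" using u redK by blast
      then have "u \<in> Q" using red[of v u] ends(2)[of v u] v by (auto simp: P_def Q_def)
      then show False using u by (simp add: S2_def)
    qed
    then have "card (red_nbrs K v - S2) = 0" by (simp only: card.empty)
    then show ?thesis using cS2 w by linarith
  qed
  have bR2: "card (red_nbrs K v - S2) \<le> w" if v: "v \<in> tverts K - S2 - P" for v
  proof -
    have "card (red_nbrs K v - S2) \<le> card (red_nbrs K v)"
      using finK by (intro card_mono) (auto simp: red_nbrs_def)
    also have "\<dots> \<le> w" using K(3) v by (auto simp: bounded_red_def red_degree_card)
    finally show ?thesis .
  qed
  have "card S2 + k \<le> w + 1" using cS2 w by simp
  then have small: "card S2 + k \<le> w + 1 \<or>
      ({} \<subseteq> S2 \<and> (\<forall>v\<in>{}. red_nbrs K v \<inter> P = {}) \<and> card {} + 2 * card (S2 - {}) \<le> k + 1)" ..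
  have "\<exists>H' S'. (bounded_step w)\<^sup>*\<^sup>* K H' \<and> is_trigraph H' \<and> bounded_red w H' \<and> agree_off S2 K H' \<and>
    S' \<subseteq> S2 \<and> card S' \<le> 1 \<and> (S' = {} \<longrightarrow> S2 = {}) \<and> tverts H' = tverts K - S2 \<union> S' \<and>
    confined H' S' P"
    by (rule contract_confined[OF K(2) conf2 cP w(1) bS2 bP2 bR2 small])
  then obtain L S3 where L: "(bounded_step w)\<^sup>*\<^sup>* K L" "is_trigraph L" "bounded_red w L"
    "agree_off S2 K L" "S3 \<subseteq> S2" "card S3 \<le> 1" "S3 = {} \<longrightarrow> S2 = {}"
    "tverts L = tverts K - S2 \<union> S3" "confined L S3 P"
    by (elim exE conjE)
  \<comment> \<open>The surviving vertex may bear a name from the leaf, so it is reassigned to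
    \<open>j\<close>.\<close>
  define f' where "f' v = (if v \<in> S3 then j else f v)" for v
  have VL: "tverts L = tverts H - S - Q \<union> S3"
    using L(8) K(5,8) by (auto simp: S2_def)
  have PS3: "P \<inter> S3 = {}" using L(5) K(5) QS unfolding S2_def by blast
  have finS3: "finite S3" using L(5) finS2 finite_subset by blast
  have endsL: "u \<in> tverts L" "v \<in> tverts L" if "{u, v} \<in> black L \<union> red L" for u v
    using L(2) that unfolding is_trigraph_def by auto
  have confL: "v \<in> S3 \<union> P" if "{u, v} \<in> black L \<union> red L" "u \<in> S3" for u v
    using L(9) that unfolding confined_def by blast
  have old: "u \<notin> S \<and> u \<notin> S2" if "u \<in> tverts L" "u \<notin> S3" for u
    using that L(8) K(8) by (auto simp: S2_def)
  \<comment> \<open>Edges meeting \<open>S3\<close> stay inside \<open>S3\<close> and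
    \<open>P\<close>, hence at node \<open>j\<close>; all others are edges of \<open>H\<close> with
    their colour unchanged.\<close>
  have edge: "f' u = f' v \<and> (u \<in> S3 \<or> v \<in> S3) \<or>
      u \<notin> S3 \<and> v \<notin> S3 \<and> ({u, v} \<in> red L \<longrightarrow> {u, v} \<in> red H) \<and> ({u, v} \<in> black L \<longrightarrow> {u, v} \<in> black H)"
    if e: "{u, v} \<in> black L \<union> red L" for u v
  proof (cases "u \<in> S3 \<or> v \<in> S3")
    case True
    then have "u \<in> S3 \<union> P" "v \<in> S3 \<union> P" using confL[of u v] confL[of v u] e by (auto simp: insert_commute)
    then show ?thesis using True by (auto simp: f'_def P_def)
  next
    case False
    then have nS: "u \<notin> S" "v \<notin> S" "u \<notin> S2" "v \<notin> S2" using old endsL[OF e] by auto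
    then have "{u, v} \<inter> S2 = {}" by blast
    then have "{u, v} \<in> red L \<longleftrightarrow> {u, v} \<in> red K" "{u, v} \<in> black L \<longleftrightarrow> {u, v} \<in> black K"
      using L(4) unfolding agree_off_def by blast+
    then show ?thesis using False redK[OF nS(1,2)] blackK[OF nS(1,2)] by blast
  qed
  have "layout k (N - {i}) E f' (C \<union> S3) L"
    unfolding layout_def
  proof (intro conjI ballI allI impI)
    show "is_trigraph L" by (rule L(2))
    show "tverts L \<noteq> {}" using H(2) L(7,8) K(7,8) by (auto simp: S2_def)
    show "f' ` tverts L \<subseteq> N - {i}" using H(3) ij by (auto simp: VL f'_def S_def)
  next
    fix l assume l: "l \<in> N - {i}"
    have "card {v \<in> tverts L - (C \<union> S3). f' v = l} \<le> card {v \<in> tverts H - C. f v = l}"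
      using fin by (intro card_mono) (auto simp: VL f'_def)
    also have "\<dots> \<le> k" using lay l by (simp add: layout_def)
    finally show "card {v \<in> tverts L - (C \<union> S3). f' v = l} \<le> k" .
    show "card {v \<in> tverts L \<inter> (C \<union> S3). f' v = l} \<le> 1"
    proof (cases "l = j")
      case True
      then have "{v \<in> tverts L \<inter> (C \<union> S3). f' v = l} \<subseteq> S3" by (auto simp: VL f'_def Q_def)
      then show ?thesis using card_mono[OF finS3] L(6) order_trans by meson
    next
      case False
      then have "card {v \<in> tverts L \<inter> (C \<union> S3). f' v = l} \<le> card {v \<in> tverts H \<inter> C. f v = l}"
        using fin by (intro card_mono) (auto simp: VL f'_def)
      also have "\<dots> \<le> 1" using lay l by (simp add: layout_def)
      finally show ?thesis .
    qed
  next
    fix u v assume e: "{u, v} \<in> red L"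
    show "f' u = f' v" "u \<in> C \<union> S3 \<or> v \<in> C \<union> S3"
      using edge[of u v] e red[of u v] by (auto simp: f'_def)
  next
    fix u v assume e: "{u, v} \<in> black L"
    show "f' u = f' v \<or> u \<notin> C \<union> S3 \<and> v \<notin> C \<union> S3 \<and> {f' u, f' v} \<in> E"
      using edge[of u v] e black[of u v] by (auto simp: f'_def)
  qed
  then show ?thesis using rtranclp_trans[OF K(1) L(1)] by blast
qed

text \<open>Induction on the number of remaining nodes. The last node holds at most
  \<open>k + 1\<close> vertices, which are contracted with empty boundary; \<open>layout\<close>
  keeps the vertex set nonempty, so exactly one vertex is left.\<close>

lemma layout_collapse:
  assumes T: "simple_graph T" "\<nexists>c. is_cycle T c" and N: "finite N"
    and lay: "layout k N (edges T) f C H" and k: "1 \<le> k" and w: "3 * k \<le> 2 * w" "k + 2 \<le> w"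
  shows "\<exists>H'. (bounded_step w)\<^sup>*\<^sup>* H H' \<and> card (tverts H') = 1"
  using N lay
proof (induction "card N" arbitrary: N f C H rule: less_induct)
  case less
  show ?case
  proof (cases "2 \<le> card N")
    case True
    obtain i j where ij: "i \<in> N" "j \<in> N" "i \<noteq> j" and leaf: "\<And>l. l \<in> N \<Longrightarrow> {i, l} \<in> edges T \<Longrightarrow> l = j"
      using forest_leaf[OF T less.prems(1) True] by blast
    obtain H1 f1 C1 where H1: "(bounded_step w)\<^sup>*\<^sup>* H H1" "layout k (N - {i}) (edges T) f1 C1 H1"
      using layout_absorb[OF less.prems(2) k w ij leaf] by blast
    have "card (N - {i}) < card N" "finite (N - {i})"
      using ij less.prems(1) True by auto
    then obtain H2 where "(bounded_step w)\<^sup>*\<^sup>* H1 H2" "card (tverts H2) = 1"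
      using less.hyps[OF _ _ H1(2)] by blast
    then show ?thesis using rtranclp_trans[OF H1(1)] by blast
  next
    case False
    have H: "is_trigraph H" "tverts H \<noteq> {}" "f ` tverts H \<subseteq> N"
      using less.prems(2) by (auto simp: layout_def)
    then have "N \<noteq> {}" by auto
    then have "card N = 1" using False less.prems(1) by (metis One_nat_def Suc_1 card_0_eq less_one not_less_eq_eq le_antisym not_less)
    then obtain i where N: "N = {i}" by (auto simp: card_1_singleton_iff)
    then have "tverts H = {v \<in> tverts H. f v = i}" using H(3) by auto
    then have cV: "card (tverts H) \<le> k + 1" using layout_fibre[OF less.prems(2), of i] N by simp
    have conf: "confined H (tverts H) {}"
      using H(1) unfolding confined_def is_trigraph_def by blast
    have "card (tverts H) + k \<le> w + 1 \<or> (tverts H \<subseteq> tverts H \<and>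
        (\<forall>v\<in>tverts H. red_nbrs H v \<inter> {} = {}) \<and> card (tverts H) + 2 * card (tverts H - tverts H) \<le> k + 1)"
      using cV by simp
    then have "\<exists>H' S'. (bounded_step w)\<^sup>*\<^sup>* H H' \<and> is_trigraph H' \<and> bounded_red w H' \<and>
        agree_off (tverts H) H H' \<and> S' \<subseteq> tverts H \<and> card S' \<le> 1 \<and> (S' = {} \<longrightarrow> tverts H = {}) \<and>
        tverts H' = tverts H - tverts H \<union> S' \<and> confined H' S' {}"
      using cV w by (intro contract_confined[OF H(1) conf _ w(1)]) auto
    then obtain H' S' where H': "(bounded_step w)\<^sup>*\<^sup>* H H'" "is_trigraph H'" "card S' \<le> 1"
      "S' = {} \<longrightarrow> tverts H = {}" "tverts H' = tverts H - tverts H \<union> S'"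
      by (elim exE conjE)
    have "finite (tverts H')" "tverts H' \<noteq> {}" "card (tverts H') \<le> 1"
      using H' H(2) by (auto simp: is_trigraph_def)
    then have "card (tverts H') = 1" by (metis card_0_eq le_less less_one)
    then show ?thesis using H'(1) by blast
  qed
qed

section \<open>From strong tree decompositions to the bound\<close>

lemma tww_le_of_decomposition:
  assumes G: "simple_graph G" "verts G \<noteq> {}" and dec: "strong_tree_decomposition G T B"
    and k: "decomposition_width T B \<le> k" "1 \<le> k"
  shows "tww G \<le> (3 * k + 3) div 2"
proof -
  have T: "simple_graph T" "\<nexists>c. is_cycle T c" and fin: "finite (verts T)"
    and disj: "disjoint_family_on B (verts T)" and cover: "(\<Union>i\<in>verts T. B i) = verts G"
    and edge: "\<And>u v. {u, v} \<in> edges G \<Longrightarrow> (\<exists>i\<in>verts T. u \<in> B i \<and> v \<in> B i) \<or>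
      (\<exists>i j. {i, j} \<in> edges T \<and> u \<in> B i \<and> v \<in> B j)"
    using dec unfolding strong_tree_decomposition_def is_tree_def simple_graph_def by auto
  \<comment> \<open>Disjointness of the bags makes the node unique for each vertex of
    \<open>G\<close>.\<close>
  define f where "f v = (THE i. i \<in> verts T \<and> v \<in> B i)" for v
  have f: "f v = i" if "i \<in> verts T" "v \<in> B i" for v i
    unfolding f_def using that disj by (intro the_equality) (auto simp: disjoint_family_on_def)
  have f_in: "f v \<in> verts T" "v \<in> B (f v)" if "v \<in> verts G" for v
    using that cover f by (metis UN_E)+
  have ends: "i \<in> verts T" "j \<in> verts T" if "{i, j} \<in> edges T" for i j
    using T(1) that unfolding simple_graph_def by auto
  have bag: "card (B i) \<le> k" if "i \<in> verts T" for i
    using k(1) fin that unfolding decomposition_width_def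
    by (meson Max_ge finite_imageI imageI order_trans)
  have finB: "finite (B i)" if "i \<in> verts T" for i
    using that cover G(1) finite_subset[of "B i" "verts G"] unfolding simple_graph_def by blast
  \<comment> \<open>Initially nothing has been absorbed, so \<open>C\<close> is empty.\<close>
  have lay: "layout k (verts T) (edges T) f {} (trigraph_of G)"
    unfolding layout_def
  proof (intro conjI ballI allI impI)
    show "is_trigraph (trigraph_of G)" by (rule is_trigraph_trigraph_of[OF G(1)])
    show "tverts (trigraph_of G) \<noteq> {}" "f ` tverts (trigraph_of G) \<subseteq> verts T"
      using G(2) f_in by (auto simp: trigraph_of_def)
  next
    fix i assume i: "i \<in> verts T"
    have "{v \<in> tverts (trigraph_of G) - {}. f v = i} \<subseteq> B i" using f_in by (auto simp: trigraph_of_def)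
    then show "card {v \<in> tverts (trigraph_of G) - {}. f v = i} \<le> k"
      using card_mono[OF finB[OF i]] bag[OF i] order_trans by meson
    show "card {v \<in> tverts (trigraph_of G) \<inter> {}. f v = i} \<le> 1" by simp
  next
    fix u v assume "{u, v} \<in> red (trigraph_of G)"
    then show "f u = f v" "u \<in> {} \<or> v \<in> {}" by (simp_all add: trigraph_of_def)
  next
    fix u v assume "{u, v} \<in> black (trigraph_of G)"
    then consider i where "i \<in> verts T" "u \<in> B i" "v \<in> B i"
      | i l where "{i, l} \<in> edges T" "u \<in> B i" "v \<in> B l"
      using edge[of u v] unfolding trigraph_of_def by auto
    then show "f u = f v \<or> u \<notin> {} \<and> v \<notin> {} \<and> {f u, f v} \<in> edges T"
    proof cases
      case 1
      then show ?thesis by (simp add: f)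
    next
      case 2
      then show ?thesis using f[OF ends(1)] f[OF ends(2)] by simp
    qed
  qed
  \<comment> \<open>The second inequality needs \<open>k \<ge> 1\<close> and is an equality at
    \<open>k = 1\<close>.\<close>
  have "3 * k \<le> 2 * ((3 * k + 3) div 2)" "k + 2 \<le> (3 * k + 3) div 2" using k(2) by linarith+
  then obtain H' where "(bounded_step ((3 * k + 3) div 2))\<^sup>*\<^sup>* (trigraph_of G) H'" "card (tverts H') = 1"
    using layout_collapse[OF T fin lay k(2)] by blast
  then show ?thesis by (intro tww_le_of_steps[OF _ G(1)])
qed

text \<open>A one-node tree with all vertices in its bag is a decomposition, so the
  \<open>LEAST\<close> ranges over a nonempty set and is attained.\<close>

lemma strong_tree_width_attained:
  assumes G: "simple_graph G"
  obtains T :: "nat graph" and B where "strong_tree_decomposition G T B"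
    "decomposition_width T B = strong_tree_width G"
proof -
  define T :: "nat graph" where "T = \<lparr>verts = {0}, edges = {}\<rparr>"
  have "is_tree T"
    unfolding is_tree_def simple_graph_def connected_graph_def is_cycle_def T_def
    by (auto intro: exI[of _ 0])
  then have "strong_tree_decomposition G T (\<lambda>_. verts G)"
    unfolding strong_tree_decomposition_def disjoint_family_on_def
    using G by (auto simp: T_def simple_graph_def)
  then have "\<exists>w (T :: nat graph) B. strong_tree_decomposition G T B \<and> decomposition_width T B = w"
    by blast
  from LeastI_ex[OF this] show thesis unfolding strong_tree_width_def[symmetric] using that by blast
qed

theorem theorem1:
  fixes G :: "'a graph" and k :: nat
  assumes "k \<ge> 1"
    and "simple_graph G"
    and "strong_tree_width G = k"
  shows "real (tww G) \<le> 3 / 2 * real k + 1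
           + 1 / 2 * (sqrt (real k + ln (real k)) + sqrt (real k) + 2 * ln (real k))"
proof -
  obtain T :: "nat graph" and B where dec: "strong_tree_decomposition G T B"
    and width: "decomposition_width T B = k"
    using strong_tree_width_attained[OF assms(2)] assms(3) by metis
  \<comment> \<open>The empty graph would have width 0; a contraction sequence needs at least one
    vertex.\<close>
  have "verts G \<noteq> {}"
  proof
    assume "verts G = {}"
    then have "\<forall>i\<in>verts T. B i = {}" using dec by (auto simp: strong_tree_decomposition_def)
    moreover have "verts T \<noteq> {}"
      using dec by (auto simp: strong_tree_decomposition_def is_tree_def connected_graph_def)
    ultimately have "decomposition_width T B = 0"
      by (simp add: decomposition_width_def image_constant_conv)
    then show False using width assms(1) by simp
  qed
  then have "tww G \<le> (3 * k + 3) div 2"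
    using tww_le_of_decomposition[OF assms(2) _ dec] width assms(1) by simp
  then have "2 * tww G \<le> 3 * k + 3" by linarith
  then have "real (2 * tww G) \<le> real (3 * k + 3)" by (rule of_nat_mono)
  then have "2 * real (tww G) \<le> 3 * real k + 3" by simp
  \<comment> \<open>The bracket in the claim is thus at least 2, so the right side is at least
    \<open>3 k / 2 + 2\<close>, above \<open>(3 k + 3) / 2\<close>.\<close>
  moreover have "0 \<le> ln (real k)" "1 \<le> sqrt (real k)" "1 \<le> sqrt (real k + ln (real k))"
    using assms(1) by (simp_all add: add_increasing2)
  moreover have "t \<le> 3 / 2 * x + 1 + 1 / 2 * (p + q + 2 * l)"
    if "2 * t \<le> 3 * x + 3" "0 \<le> l" "1 \<le> q" "1 \<le> p" for t x l p q :: real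
    using that by (simp add: field_simps)
  ultimately show ?thesis by blast
qed

end
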